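(* Let $G = (V, E)$ be a finite regular undirected graph and let $\lambda = \lambda(G)$. Let $n \ge 1$, let $f_1, \ldots, f_n: V \rightarrow [0, 1]$, and let $\mu_i = \mathbb{E}[f_i(v)]$, where $v$ is uniformly distributed on $V$. Let $(Y_1, \ldots, Y_n)$ be the simple random walk on $G$ started at a uniformly random vertex, let $S_n = f_1(Y_1)+\cdots+f_n(Y_n)$, and let $\Phi := \mathbb{E}[S_n] = \mu_1 + \cdots + \mu_n$. Then for every real $\alpha$ with $1 < \alpha < 1/\lambda$, $$\mathbb{E}[\alpha^{S_n}] \leq \exp\left((\alpha-1) \cdot \Phi \cdot \frac{1-\lambda}{1-\alpha\lambda}\right).$$
   Context: For a finite $d$-regular undirected graph $G=(V,E)$ (self-loops are allowed; $d \ge 1$), the normalized adjacency matrix $A$ is the adjacency matrix divided by $d$, i.e. the transition matrix of the simple random walk. Let $J$ be the $|V|\times|V|$ matrix all of whose entries equal $1/|V|$, and define $\lambda(G) = \|A - J\|$, where $\|\cdot\|$ is the $\ell_2\to\ell_2$ operator norm. The simple random walk $(Y_1,\ldots,Y_n)$ of length $n$ on $G$: $Y_1$ is uniform on $V$, and each subsequent $Y_i$ is chosen uniformly from the neighbors of $Y_{i-1}$ (i.e. according to the transition matrix $A$). If $\lambda = 0$, then $1/\lambda$ is read as $+\infty$, so the condition on $\alpha$ is just $\alpha>1$. *)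

theory Defs
  imports "HOL-Probability.Probability"
begin

text \<open>
  The vertex set is the finite type \<open>'v\<close>. An undirected graph is given by its set of edges, an edge
  being an unordered pair \<open>{u, v}\<close>; a self-loop at \<open>v\<close> is the edge \<open>{v, v} = {v}\<close>.
\<close>

definition undirected_graph :: "'v set set \<Rightarrow> bool" where
  "undirected_graph E \<longleftrightarrow> (\<forall>e\<in>E. \<exists>u v. e = {u, v})"

definition neighbors :: "'v set set \<Rightarrow> 'v \<Rightarrow> 'v set" where
  "neighbors E v = {w. {v, w} \<in> E}"

text \<open>
  A vertex with a self-loop is one of its own neighbors, so a loop adds one to the degree. This makes
  the rows of the normalized adjacency matrix of a regular graph sum to one.
\<close>

definition regular_graph :: "('v::finite) set set \<Rightarrow> nat \<Rightarrow> bool" where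
  "regular_graph E d \<longleftrightarrow> undirected_graph E \<and> d \<ge> 1 \<and> (\<forall>v. card (neighbors E v) = d)"

definition adjacency_matrix :: "('v::finite) set set \<Rightarrow> real ^ 'v ^ 'v" where
  "adjacency_matrix E = (\<chi> u v. if {u, v} \<in> E then 1 else 0)"

definition normalized_adjacency_matrix :: "('v::finite) set set \<Rightarrow> nat \<Rightarrow> real ^ 'v ^ 'v" where
  "normalized_adjacency_matrix E d = (1 / real d) *\<^sub>R adjacency_matrix E"

definition averaging_matrix :: "real ^ ('v::finite) ^ 'v" where
  "averaging_matrix = (\<chi> u v. 1 / real CARD('v))"

text \<open>The norm on \<^typ>\<open>real ^ 'v\<close> is the Euclidean one, so \<^const>\<open>onorm\<close> is the operator norm
  from \<open>\<ell>\<^sub>2\<close> to \<open>\<ell>\<^sub>2\<close>.\<close>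

definition spectral_expansion :: "('v::finite) set set \<Rightarrow> nat \<Rightarrow> real" where
  "spectral_expansion E d =
     onorm (\<lambda>x. (normalized_adjacency_matrix E d - averaging_matrix) *v x)"

text \<open>The joint law of \<open>(Y\<^sub>1, \<dots>, Y\<^sub>n)\<close>, as a distribution on vertex lists of length \<open>n\<close>.\<close>

primrec random_walk :: "('v::finite) set set \<Rightarrow> nat \<Rightarrow> 'v list pmf" where
  "random_walk E 0 = return_pmf []"
| "random_walk E (Suc n) =
     bind_pmf (random_walk E n) (\<lambda>ys.
       map_pmf (\<lambda>y. ys @ [y])
         (if ys = [] then pmf_of_set UNIV else pmf_of_set (neighbors E (last ys))))"

text \<open>\<open>Y\<^sub>i\<close> is the list entry at position \<open>i - 1\<close>.\<close>

definition walk_sum :: "nat \<Rightarrow> (nat \<Rightarrow> 'v \<Rightarrow> real) \<Rightarrow> 'v list \<Rightarrow> real" where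
  "walk_sum n f ys = (\<Sum>i=1..n. f i (ys ! (i - 1)))"

end

theory Submission
  imports Defs
begin

text \<open>
  Write \<open>g\<^sub>i = 1 + (\<alpha> - 1) f\<^sub>i\<close>. Since \<open>t \<mapsto> \<alpha> powr t\<close> is convex, its graph over \<open>[0, 1]\<close> lies below
  the chord, so \<open>\<alpha> powr S\<^sub>n\<close> is at most the product of the \<open>g\<^sub>i(Y\<^sub>i)\<close>. The expectation of this
  product is the mean of a vector obtained from the constant function \<open>1\<close> by alternately multiplying
  by some \<open>g\<^sub>i\<close> and applying the walk operator \<open>A\<close>. Let \<open>J\<close> be the averaging operator and
  \<open>C = J + L (I - J)\<close> with \<open>\<lambda> \<le> L < 1 / \<alpha>\<close> and \<open>L > 0\<close>. The growth of these vectors is measured in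
  the norm whose square is the quadratic form of the inverse of \<open>C\<close>, namely
  \<open>energy L h = (avg h)\<^sup>2 + var h / L\<close>, in which \<open>1\<close> has norm \<open>1\<close>.

  One factor \<open>g\<close> together with one step of \<open>A\<close> increases this norm by a factor of at most
  \<open>R = 1 + (\<alpha> - 1) \<mu> (1 - L) / (1 - \<alpha> L)\<close>, where \<open>\<mu>\<close> is the mean of \<open>f\<close>. Two facts give this.

  \<^item> As quadratic forms, multiplication by \<open>g\<close> is bounded by \<open>R\<close> times the inverse of \<open>C\<close>
    (\<open>reweighted_square_le_energy\<close>). After splitting \<open>h\<close> into its mean and its fluctuation, this is
    Young's inequality with the parameter that makes the coefficient of the mean part exactly
    \<open>(1 - L) / (1 - \<alpha> L)\<close>.

  \<^item> If a nonnegative multiplication operator \<open>D\<close> satisfies \<open>D \<le> R * inverse C\<close>, then \<open>D C D \<le> R\<^sup>2 * inverse C\<close>,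
    by the Cauchy--Schwarz inequality with weight \<open>D\<close>; and the energy of \<open>A y\<close> is at most the form
    of \<open>C\<close> at \<open>y\<close>, as \<open>A\<close> preserves the mean and contracts the variance by \<open>\<lambda>\<^sup>2\<close>
    (\<open>energy_contraction\<close>).

  Thus the expectation is at most the product of the factors \<open>R\<close> (\<open>expectation_prod_le\<close>), and
  \<open>1 + x \<le> exp x\<close> turns this product into the exponential of a sum. The form of the inverse of \<open>C\<close>
  makes sense for \<open>L > 0\<close> only, while \<open>\<lambda>\<close> may vanish; the bound for \<open>\<lambda>\<close> itself is the limit as \<open>L\<close>
  decreases to \<open>\<lambda>\<close>. The mean of \<open>S\<^sub>n\<close> is the sum of the \<open>\<mu>\<^sub>i\<close> because every \<open>Y\<^sub>i\<close> is uniform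
  (\<open>expectation_random_walk_nth\<close>).
\<close>

section \<open>Mean, variance and energy of functions on the vertices\<close>

definition avg :: "('v::finite \<Rightarrow> real) \<Rightarrow> real" where
  "avg h = (\<Sum>v\<in>UNIV. h v) / real CARD('v)"

definition var :: "('v::finite \<Rightarrow> real) \<Rightarrow> real" where
  "var h = avg (\<lambda>v. (h v - avg h)\<^sup>2)"

text \<open>
  The quadratic form of the inverse of \<open>J + L (I - J)\<close>, where \<open>J\<close> is the averaging operator. A
  step that contracts the variance by \<open>L\<^sup>2\<close> turns the weight \<open>1 / L\<close> of the variance into \<open>L\<close>, its weight
  in the quadratic form of \<open>J + L (I - J)\<close> itself.
\<close>

definition energy :: "real \<Rightarrow> ('v::finite \<Rightarrow> real) \<Rightarrow> real" where
  "energy L h = (avg h)\<^sup>2 + var h / L"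

lemma expectation_uniform: "measure_pmf.expectation (pmf_of_set UNIV) h = avg h"
  by (simp add: integral_pmf_of_set avg_def)

lemma avg_const [simp]: "avg (\<lambda>v::'v::finite. c) = c"
  by (simp add: avg_def)

lemma avg_add: "avg (\<lambda>v. g v + h v) = avg g + avg h"
  by (simp add: avg_def sum.distrib add_divide_distrib)

lemma avg_diff: "avg (\<lambda>v. g v - h v) = avg g - avg h"
  by (simp add: avg_def sum_subtractf diff_divide_distrib)

lemma avg_cmult: "avg (\<lambda>v. c * h v) = c * avg h"
  by (simp add: avg_def sum_distrib_left)

lemma avg_mono: "(\<And>v. g v \<le> h v) \<Longrightarrow> avg g \<le> avg h"
  by (simp add: avg_def divide_right_mono sum_mono)

lemma avg_nonneg: "(\<And>v. 0 \<le> h v) \<Longrightarrow> 0 \<le> avg h"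
  by (simp add: avg_def sum_nonneg)

lemma var_nonneg: "0 \<le> var h"
  by (simp add: var_def avg_nonneg)

lemma energy_nonneg: "0 < L \<Longrightarrow> 0 \<le> energy L h"
  by (simp add: energy_def var_nonneg)

lemma avg_centred [simp]: "avg (\<lambda>v. h v - avg h) = 0"
  by (simp add: avg_diff)

lemma avg_square_eq: "avg (\<lambda>v. (h v)\<^sup>2) = (avg h)\<^sup>2 + var h"
proof -
  have "avg (\<lambda>v. (h v)\<^sup>2) = avg (\<lambda>v. ((avg h)\<^sup>2 + (2 * avg h) * (h v - avg h)) + (h v - avg h)\<^sup>2)"
    by (simp add: power2_eq_square algebra_simps)
  then show ?thesis
    by (simp only: avg_add avg_cmult avg_centred avg_const var_def)
qed

lemma avg_Cauchy_Schwarz: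
  assumes "\<And>v. 0 \<le> g v"
  shows "(avg (\<lambda>v. g v * h v * x v))\<^sup>2 \<le> avg (\<lambda>v. g v * (h v)\<^sup>2) * avg (\<lambda>v. g v * (x v)\<^sup>2)"
proof -
  have "(\<Sum>v\<in>UNIV. g v * h v * x v) = (\<Sum>v\<in>UNIV. (sqrt (g v) * h v) * (sqrt (g v) * x v))"
    using assms by (intro sum.cong) (auto simp: algebra_simps)
  moreover have "(\<Sum>v\<in>UNIV. g v * (y v)\<^sup>2) = (\<Sum>v\<in>UNIV. (sqrt (g v) * y v)\<^sup>2)" for y
    using assms by (intro sum.cong) (auto simp: power_mult_distrib)
  ultimately have "(\<Sum>v\<in>UNIV. g v * h v * x v)\<^sup>2
      \<le> (\<Sum>v\<in>UNIV. g v * (h v)\<^sup>2) * (\<Sum>v\<in>UNIV. g v * (x v)\<^sup>2)"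
    using Cauchy_Schwarz_ineq_sum[of "\<lambda>v. sqrt (g v) * h v" "\<lambda>v. sqrt (g v) * x v" UNIV] by simp
  then show ?thesis
    by (simp add: avg_def power_divide divide_right_mono power2_eq_square[of "real CARD(_)"])
qed

section \<open>The effect of one factor\<close>

text \<open>
  The plain mean of \<open>h\<^sup>2\<close> uses only a part of the energy: it leaves \<open>(1 - L) / L\<close> times the variance
  to spare. Young's inequality bounds \<open>(\<alpha> - 1) f h\<^sup>2\<close> by a multiple of \<open>f (avg h)\<^sup>2\<close> plus a multiple of
  the squared fluctuation; its parameter is chosen so that the second multiple is exactly what was left
  to spare.
\<close>

lemma reweighted_square_le_energy:
  assumes f: "\<And>v. 0 \<le> f v" "\<And>v. f v \<le> 1"
    and \<alpha>: "1 < \<alpha>" and L: "0 < L" "\<alpha> * L < 1"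
  shows "avg (\<lambda>v. (1 + (\<alpha> - 1) * f v) * (h v)\<^sup>2)
    \<le> (1 + (\<alpha> - 1) * ((1 - L) / (1 - \<alpha> * L)) * avg f) * energy L h"
proof -
  define k where "k = (1 - L) / (1 - \<alpha> * L)"
  define c where "c = (1 - L) / L"
  define z where "z v = h v - avg h" for v
  have L1: "L < 1" using \<alpha> L by (smt (verit) mult_less_cancel_right1)
  have k0: "0 \<le> k" and c0: "0 \<le> c" using L1 L by (simp_all add: k_def c_def)
  \<comment> \<open>With \<open>p = (\<alpha> - 1) L\<close> and \<open>q = 1 - \<alpha> L\<close>, so that \<open>p + q = 1 - L\<close>, the difference of the two
     sides is a multiple of the square of \<open>p * avg h - q * z v\<close>.\<close>
  have Young: "(\<alpha> - 1) * (h v)\<^sup>2 \<le> (\<alpha> - 1) * k * (avg h)\<^sup>2 + c * (z v)\<^sup>2" for v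
  proof -
    define p where "p = (\<alpha> - 1) * L"
    have p: "0 < p" using \<alpha> L by (simp add: p_def)
    define q where "q = 1 - \<alpha> * L"
    have q: "0 < q" using L by (simp add: q_def)
    have pq: "1 - L = p + q" by (simp add: p_def q_def algebra_simps)
    have "(\<alpha> - 1) * k * (avg h)\<^sup>2 + c * (z v)\<^sup>2 - (\<alpha> - 1) * (h v)\<^sup>2
       = (\<alpha> - 1) * ((p + q) / q * (avg h)\<^sup>2 + (p + q) / p * (z v)\<^sup>2 - (avg h + z v)\<^sup>2)"
    proof -
      have "k = (p + q) / q" by (simp add: k_def pq q_def)
      moreover have "c = (\<alpha> - 1) * ((p + q) / p)"
        using \<alpha> by (simp add: c_def pq p_def)
      ultimately show ?thesis by (simp add: z_def algebra_simps)
    qed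
    also have "(p + q) / q * (avg h)\<^sup>2 + (p + q) / p * (z v)\<^sup>2 - (avg h + z v)\<^sup>2
       = (p * avg h - q * z v)\<^sup>2 / (p * q)"
      using p q by (simp add: field_simps power2_eq_square)
    finally have "(\<alpha> - 1) * k * (avg h)\<^sup>2 + c * (z v)\<^sup>2 - (\<alpha> - 1) * (h v)\<^sup>2
       = (\<alpha> - 1) * ((p * avg h - q * z v)\<^sup>2 / (p * q))" .
    moreover have "0 \<le> (\<alpha> - 1) * ((p * avg h - q * z v)\<^sup>2 / (p * q))" using \<alpha> p q by simp
    ultimately show ?thesis by linarith
  qed
  have "(\<alpha> - 1) * f v * (h v)\<^sup>2 \<le> (\<alpha> - 1) * k * (avg h)\<^sup>2 * f v + c * (z v)\<^sup>2" for v
  proof -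
    have "f v * ((\<alpha> - 1) * (h v)\<^sup>2) \<le> f v * ((\<alpha> - 1) * k * (avg h)\<^sup>2 + c * (z v)\<^sup>2)"
      using Young f(1) by (intro mult_left_mono) auto
    moreover have "f v * (c * (z v)\<^sup>2) \<le> 1 * (c * (z v)\<^sup>2)"
      using f(2) c0 by (intro mult_right_mono) auto
    ultimately show ?thesis by (simp add: algebra_simps)
  qed
  then have "avg (\<lambda>v. (1 + (\<alpha> - 1) * f v) * (h v)\<^sup>2)
     \<le> avg (\<lambda>v. (h v)\<^sup>2 + ((\<alpha> - 1) * k * (avg h)\<^sup>2 * f v + c * (z v)\<^sup>2))"
    by (intro avg_mono) (simp add: algebra_simps)
  also have "\<dots> = (avg h)\<^sup>2 + var h + (\<alpha> - 1) * k * (avg h)\<^sup>2 * avg f + c * var h"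
    by (simp only: avg_add avg_cmult avg_square_eq[of h]) (simp add: var_def z_def)
  also have "\<dots> = (1 + (\<alpha> - 1) * k * avg f) * (avg h)\<^sup>2 + var h / L"
    using L by (simp add: c_def field_simps)
  \<comment> \<open>The variance term may be enlarged, as the factor is at least \<open>1\<close>.\<close>
  also have "\<dots> \<le> (1 + (\<alpha> - 1) * k * avg f) * (avg h)\<^sup>2 + (1 + (\<alpha> - 1) * k * avg f) * (var h / L)"
    using mult_right_mono[of 1 "1 + (\<alpha> - 1) * k * avg f" "var h / L"] \<alpha> L k0 avg_nonneg[of f] f(1)
    by (simp add: var_nonneg)
  finally show ?thesis by (simp add: k_def energy_def distrib_left)
qed

text \<open>
  Let \<open>C = J + L (I - J)\<close> and \<open>y = g h\<close>. First,
  \<open>energy L (A y) \<le> \<langle>y, C y\<rangle>\<close>, because \<open>A\<close> preserves the mean and contracts the variance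
  by \<open>L\<^sup>2\<close>. With \<open>x = C y\<close> one has
  \<open>\<langle>y, C y\<rangle> = \<langle>g h, x\<rangle> = energy L x\<close>, and the Cauchy--Schwarz inequality with weight \<open>g\<close>, followed by
  the assumed bound at \<open>h\<close> and at \<open>x\<close>, makes the square of this number at most
  \<open>R\<^sup>2\<close> times \<open>energy L h\<close> times the number itself.
\<close>

lemma energy_contraction:
  fixes A :: "('v::finite \<Rightarrow> real) \<Rightarrow> 'v \<Rightarrow> real"
  assumes A_avg: "\<And>y. avg (A y) = avg y" and A_var: "\<And>y. var (A y) \<le> L\<^sup>2 * var y"
    and g: "\<And>v. 0 \<le> g v" and L: "0 < L" and R: "0 \<le> R"
    and gR: "\<And>x. avg (\<lambda>v. g v * (x v)\<^sup>2) \<le> R * energy L x"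
  shows "energy L (A (\<lambda>v. g v * h v)) \<le> R\<^sup>2 * energy L h"
proof -
  define y where "y v = g v * h v" for v
  define x where "x v = avg y + L * (y v - avg y)" for v
  define T where "T = (avg y)\<^sup>2 + L * var y"
  have T0: "0 \<le> T" using L by (simp add: T_def var_nonneg)
  have "energy L (A y) \<le> (avg y)\<^sup>2 + L\<^sup>2 * var y / L"
    unfolding energy_def using A_avg A_var[of y] L by (simp add: divide_right_mono)
  also have "\<dots> = T" using L by (simp add: T_def power2_eq_square)
  finally have AT: "energy L (A y) \<le> T" .
  have ax: "avg x = avg y"
    unfolding x_def by (simp only: avg_add avg_cmult avg_centred avg_const mult_zero_right add_0_right)
  have "var x = L\<^sup>2 * var y"
    by (simp add: var_def ax) (simp add: x_def power_mult_distrib avg_cmult)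
  then have ex: "energy L x = T"
    using L by (simp add: energy_def ax T_def power2_eq_square)
  have "avg (\<lambda>v. y v * x v) = avg (\<lambda>v. avg y * y v + L * ((y v)\<^sup>2 - avg y * y v))"
    by (simp add: x_def algebra_simps power2_eq_square)
  also have "\<dots> = T"
    by (simp only: avg_add avg_diff avg_cmult avg_square_eq T_def)
       (simp only: power2_eq_square add_diff_cancel_left')
  finally have "T\<^sup>2 = (avg (\<lambda>v. g v * h v * x v))\<^sup>2" by (simp add: y_def)
  also have "\<dots> \<le> avg (\<lambda>v. g v * (h v)\<^sup>2) * avg (\<lambda>v. g v * (x v)\<^sup>2)"
    by (rule avg_Cauchy_Schwarz) (rule g)
  also have "\<dots> \<le> (R * energy L h) * (R * energy L x)"
    using g R by (intro mult_mono gR) (auto intro!: avg_nonneg mult_nonneg_nonneg energy_nonneg L)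
  finally have "T * T \<le> (R\<^sup>2 * energy L h) * T"
    by (simp add: ex power2_eq_square mult_ac)
  then have "T \<le> R\<^sup>2 * energy L h"
    using T0 energy_nonneg[OF L, of h] by (cases "T = 0") auto
  then show ?thesis using AT by (simp add: y_def[abs_def])
qed

section \<open>The walk operator and its spectral gap\<close>

text \<open>The normalized adjacency matrix, acting on functions on the vertices.\<close>

definition walk_op :: "('v::finite) set set \<Rightarrow> nat \<Rightarrow> ('v \<Rightarrow> real) \<Rightarrow> 'v \<Rightarrow> real" where
  "walk_op E d h v = (\<Sum>w\<in>neighbors E v. h w) / real d"

lemma neighbors_sym: "w \<in> neighbors E v \<longleftrightarrow> v \<in> neighbors E w"
  by (simp add: neighbors_def insert_commute)

text \<open>The walk is reversible: each vertex is a neighbor of exactly \<open>d\<close> vertices.\<close>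

lemma avg_walk_op:
  assumes "regular_graph E d"
  shows "avg (walk_op E d h) = avg h"
proof -
  have d: "d \<noteq> 0" and card: "card (neighbors E w) = d" for w
    using assms by (auto simp: regular_graph_def)
  have "(\<Sum>v\<in>UNIV. \<Sum>w\<in>neighbors E v. h w) = (\<Sum>v\<in>UNIV. \<Sum>w\<in>{w. v \<in> neighbors E w}. h w)"
    using neighbors_sym[of _ E] by (intro sum.cong) auto
  also have "\<dots> = (\<Sum>w\<in>UNIV. \<Sum>v\<in>neighbors E w. h w)"
    using sum.swap_restrict[of UNIV UNIV "\<lambda>v w. h w" "\<lambda>v w. v \<in> neighbors E w"] by simp
  also have "\<dots> = real d * (\<Sum>w\<in>UNIV. h w)"
    by (simp add: card sum_distrib_left)
  finally show ?thesis
    using d by (simp add: avg_def walk_op_def sum_divide_distrib[symmetric])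
qed

lemma var_eq_norm: "var h * real CARD('v) = (norm (\<chi> v::'v::finite. h v - avg h))\<^sup>2"
  by (simp add: var_def avg_def norm_vec_def L2_set_def sum_nonneg)

text \<open>
  \<open>A - J\<close> maps the centred version of \<open>h\<close> to the centred version of \<open>A h\<close>, so its operator norm
  bounds the ratio of their Euclidean norms.
\<close>

lemma var_walk_op:
  fixes E :: "('v::finite) set set"
  assumes "regular_graph E d"
  shows "var (walk_op E d h) \<le> (spectral_expansion E d)\<^sup>2 * var h"
proof -
  let ?M = "normalized_adjacency_matrix E d - averaging_matrix"
  define x :: "real ^ 'v" where "x = (\<chi> v. h v - avg h)"
  have d: "d \<noteq> 0" and card: "card (neighbors E w) = d" for w
    using assms by (auto simp: regular_graph_def)
  have "?M *v x = (\<chi> v. walk_op E d h v - avg (walk_op E d h))"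
  proof (rule vec_eq_iff[THEN iffD2], rule allI)
    fix v
    have "(\<Sum>w\<in>UNIV. (if {v, w} \<in> E then 1 else 0) * (h w - avg h))
       = (\<Sum>w\<in>neighbors E v. h w - avg h)"
      using sum.inter_filter[of UNIV "\<lambda>w. h w - avg h" "\<lambda>w. {v, w} \<in> E"]
      by (simp add: neighbors_def if_distrib[of "\<lambda>x. x * _"] cong: if_cong)
    also have "\<dots> = (\<Sum>w\<in>neighbors E v. h w) - d * avg h"
      by (simp add: sum_subtractf card)
    finally have *: "(\<Sum>w\<in>UNIV. (if {v, w} \<in> E then 1 else 0) * (h w - avg h)) / d
        = walk_op E d h v - avg h"
      using d by (simp add: walk_op_def diff_divide_distrib)
    have **: "(\<Sum>w\<in>UNIV. h w - avg h) = 0"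
      using avg_centred[of h] by (simp add: avg_def)
    have "(?M *v x) $ v = (\<Sum>w\<in>UNIV. (if {v, w} \<in> E then 1 else 0) * (h w - avg h)) / d
        - (\<Sum>w\<in>UNIV. h w - avg h) / real CARD('v)"
      unfolding sum_divide_distrib sum_subtractf[symmetric]
      by (simp add: matrix_vector_mult_def x_def normalized_adjacency_matrix_def
          adjacency_matrix_def averaging_matrix_def left_diff_distrib)
    then show "(?M *v x) $ v = (\<chi> v. walk_op E d h v - avg (walk_op E d h)) $ v"
      using * ** by (simp add: avg_walk_op[OF assms])
  qed
  moreover have "norm (?M *v x) \<le> spectral_expansion E d * norm x"
    unfolding spectral_expansion_def by (rule onorm) (rule matrix_vector_mul_bounded_linear)
  ultimately have "(norm (\<chi> v. walk_op E d h v - avg (walk_op E d h)))\<^sup>2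
      \<le> (spectral_expansion E d * norm x)\<^sup>2"
    by (metis norm_ge_zero power_mono)
  then have "var (walk_op E d h) * CARD('v) \<le> (spectral_expansion E d)\<^sup>2 * var h * CARD('v)"
    unfolding var_eq_norm mult.assoc by (simp add: power_mult_distrib x_def)
  then show ?thesis by simp
qed

section \<open>Expectations along the walk\<close>

lemma finite_random_walk: "finite (set_pmf (random_walk E n))"
proof (induction n)
  case (Suc n) then show ?case by auto
qed simp

lemma length_random_walk: "ys \<in> set_pmf (random_walk E n) \<Longrightarrow> length ys = n"
  by (induction n arbitrary: ys) (force split: if_splits)+

lemma random_walk_1: "random_walk E (Suc 0) = map_pmf (\<lambda>y. [y]) (pmf_of_set UNIV)"
  by (simp add: bind_return_pmf)

text \<open>
  Conditioning on all but the last position. The first position follows a different rule, so there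
  must be an earlier one to step from.
\<close>

lemma expectation_random_walk_Suc:
  fixes F :: "'v::finite list \<Rightarrow> real"
  assumes "regular_graph E d" "1 \<le> n"
  shows "measure_pmf.expectation (random_walk E (Suc n)) F
   = measure_pmf.expectation (random_walk E n) (\<lambda>ys. walk_op E d (\<lambda>y. F (ys @ [y])) (last ys))"
proof -
  have d: "d \<noteq> 0" and card: "card (neighbors E w) = d" for w
    using assms by (auto simp: regular_graph_def)
  then have ne: "neighbors E w \<noteq> {}" for w by (metis card.empty)
  have "measure_pmf.expectation (random_walk E (Suc n)) F
   = (\<Sum>ys\<in>set_pmf (random_walk E n). pmf (random_walk E n) ys *
       measure_pmf.expectation (if ys = [] then pmf_of_set UNIV else pmf_of_set (neighbors E (last ys))) (\<lambda>y. F (ys @ [y])))"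
    unfolding random_walk.simps
    by (subst pmf_expectation_bind[OF finite_random_walk _ subset_refl]) auto
  also have "\<dots> = (\<Sum>ys\<in>set_pmf (random_walk E n). pmf (random_walk E n) ys * walk_op E d (\<lambda>y. F (ys @ [y])) (last ys))"
  proof (intro sum.cong refl)
    fix ys assume "ys \<in> set_pmf (random_walk E n)"
    then have "ys \<noteq> []" using length_random_walk assms(2) by fastforce
    then show "pmf (random_walk E n) ys *
       measure_pmf.expectation (if ys = [] then pmf_of_set UNIV else pmf_of_set (neighbors E (last ys))) (\<lambda>y. F (ys @ [y]))
      = pmf (random_walk E n) ys * walk_op E d (\<lambda>y. F (ys @ [y])) (last ys)"
      by (simp add: integral_pmf_of_set ne card walk_op_def)
  qed
  finally show ?thesis
    by (simp add: integral_measure_pmf[OF finite_random_walk])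
qed

text \<open>The uniform distribution is stationary: this is the invariance of the mean under the walk operator.\<close>

lemma expectation_random_walk_nth:
  fixes h :: "'v::finite \<Rightarrow> real"
  assumes "regular_graph E d" "i < n"
  shows "measure_pmf.expectation (random_walk E n) (\<lambda>ys. h (ys ! i)) = avg h"
  using assms(2)
proof (induction n arbitrary: h i)
  case (Suc n)
  show ?case
  proof (cases n)
    case 0
    then show ?thesis using Suc.prems
      by (simp add: random_walk_1 expectation_uniform del: random_walk.simps)
  next
    case (Suc m)
    have d: "d \<noteq> 0" and card: "card (neighbors E w) = d" for w
      using assms by (auto simp: regular_graph_def)
    have const: "walk_op E d (\<lambda>y. c) v = c" for c v using d by (simp add: walk_op_def card)
    have "measure_pmf.expectation (random_walk E (Suc n)) (\<lambda>ys. h (ys ! i))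
       = measure_pmf.expectation (random_walk E n) (\<lambda>ys. walk_op E d (\<lambda>y. h ((ys @ [y]) ! i)) (last ys))"
      by (rule expectation_random_walk_Suc[OF assms(1)]) (simp add: Suc)
    also have "\<dots> = measure_pmf.expectation (random_walk E n)
        (\<lambda>ys. if i < n then h (ys ! i) else walk_op E d h (ys ! (n - 1)))"
      using \<open>i < Suc n\<close> by (intro integral_cong_AE)
        (auto simp: AE_measure_pmf_iff nth_append const Suc last_conv_nth dest!: length_random_walk)
    also have "\<dots> = avg h"
      using Suc.IH[of i h] Suc.IH[of "n - 1" "walk_op E d h"]
      by (cases "i < n") (simp_all add: Suc avg_walk_op[OF assms(1)] del: random_walk.simps)
    finally show ?thesis .
  qed
qed simp

section \<open>The moment generating function\<close>

text \<open>
  The test function \<open>h\<close> at the last position makes an induction on the length possible: conditioning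
  on all but the last position replaces \<open>h\<close> by \<open>A (g\<^sub>n h)\<close>, whose energy \<open>energy_contraction\<close> controls.
\<close>

lemma expectation_prod_le:
  fixes E :: "('v::finite) set set" and h :: "'v \<Rightarrow> real"
  assumes E: "regular_graph E d" "spectral_expansion E d \<le> L"
    and \<alpha>: "1 < \<alpha>" and L: "0 < L" "\<alpha> * L < 1"
    and "1 \<le> n" and "\<And>i v. i \<in> {1..n} \<Longrightarrow> f i v \<in> {0..1}"
  shows "measure_pmf.expectation (random_walk E n)
      (\<lambda>ys. (\<Prod>i=1..n. 1 + (\<alpha> - 1) * f i (ys ! (i - 1))) * h (last ys))
    \<le> (\<Prod>i=1..n. 1 + (\<alpha> - 1) * ((1 - L) / (1 - \<alpha> * L)) * avg (f i)) * sqrt (energy L h)"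
proof -
  define g where "g \<phi> v = 1 + (\<alpha> - 1) * \<phi> v" for \<phi> and v :: 'v
  define R where "R \<phi> = 1 + (\<alpha> - 1) * ((1 - L) / (1 - \<alpha> * L)) * avg \<phi>" for \<phi> :: "'v \<Rightarrow> real"
  have L1: "L < 1" using \<alpha> L by (smt (verit) mult_less_cancel_right1)
  have g: "0 \<le> g \<phi> v" if "\<And>v. \<phi> v \<in> {0..1}" for \<phi> v using that[of v] \<alpha> by (simp add: g_def)
  have R: "0 \<le> R \<phi>" if "\<And>v. \<phi> v \<in> {0..1}" for \<phi>
    using \<alpha> L L1 that by (simp add: R_def avg_nonneg)
  have gR: "avg (\<lambda>v. g \<phi> v * (x v)\<^sup>2) \<le> R \<phi> * energy L x" if "\<And>v. \<phi> v \<in> {0..1}" for \<phi> x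
    unfolding g_def R_def using that by (intro reweighted_square_le_energy \<alpha> L) auto
  have var: "var (walk_op E d y) \<le> L\<^sup>2 * var y" for y
  proof -
    have "0 \<le> spectral_expansion E d" unfolding spectral_expansion_def
      by (rule onorm_pos_le) (rule matrix_vector_mul_bounded_linear)
    then have "(spectral_expansion E d)\<^sup>2 * var y \<le> L\<^sup>2 * var y"
      using E(2) by (intro mult_right_mono power_mono var_nonneg)
    then show ?thesis using var_walk_op[OF E(1), of y] by linarith
  qed
  have "measure_pmf.expectation (random_walk E n) (\<lambda>ys. (\<Prod>i=1..n. g (f i) (ys ! (i - 1))) * h (last ys))
    \<le> (\<Prod>i=1..n. R (f i)) * sqrt (energy L h)"
    using assms(6,7)
  proof (induction n arbitrary: h rule: nat_induct_at_least)
    case base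
    have f: "f 1 v \<in> {0..1}" for v using base by auto
    \<comment> \<open>The first position is uniform and no step precedes it, so only one factor \<open>R\<close> has to be paid:
       this is the Cauchy--Schwarz inequality between \<open>h\<close> and the constant \<open>1\<close>, of energy \<open>1\<close>.\<close>
    have "(avg (\<lambda>v. g (f 1) v * 1 * h v))\<^sup>2 \<le> avg (\<lambda>v. g (f 1) v * 1\<^sup>2) * avg (\<lambda>v. g (f 1) v * (h v)\<^sup>2)"
      by (rule avg_Cauchy_Schwarz) (rule g[OF f])
    also have "\<dots> \<le> (R (f 1) * energy L (\<lambda>v::'v. 1)) * (R (f 1) * energy L h)"
      using R[OF f] g[OF f]
      by (intro mult_mono gR f) (auto intro!: avg_nonneg mult_nonneg_nonneg energy_nonneg L)
    also have "\<dots> = (R (f 1))\<^sup>2 * energy L h"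
      by (simp add: energy_def var_def power2_eq_square)
    finally have "avg (\<lambda>v. g (f 1) v * h v) \<le> sqrt ((R (f 1))\<^sup>2 * energy L h)"
      by (intro real_le_rsqrt) simp
    also have "\<dots> = R (f 1) * sqrt (energy L h)" using R[OF f] by (simp add: real_sqrt_mult)
    finally show ?case
      by (simp add: random_walk_1 expectation_uniform del: random_walk.simps)
  next
    case (Suc n)
    have f: "f i v \<in> {0..1}" if "i \<in> {1..Suc n}" for i v using Suc.prems[OF that] .
    have f_Suc: "f (Suc n) v \<in> {0..1}" for v using f by simp
    have P: "0 \<le> (\<Prod>i=1..n. R (f i))" using f by (intro prod_nonneg R) auto
    have "measure_pmf.expectation (random_walk E (Suc n))
        (\<lambda>ys. (\<Prod>i=1..Suc n. g (f i) (ys ! (i - 1))) * h (last ys))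
      = measure_pmf.expectation (random_walk E n)
        (\<lambda>ys. (\<Prod>i=1..n. g (f i) (ys ! (i - 1))) * walk_op E d (\<lambda>v. g (f (Suc n)) v * h v) (last ys))"
    proof -
      have "walk_op E d (\<lambda>y. (\<Prod>i=1..Suc n. g (f i) ((ys @ [y]) ! (i - 1))) * h (last (ys @ [y]))) (last ys)
        = (\<Prod>i=1..n. g (f i) (ys ! (i - 1))) * walk_op E d (\<lambda>v. g (f (Suc n)) v * h v) (last ys)"
        if "ys \<in> set_pmf (random_walk E n)" for ys
      proof -
        have len: "length ys = n" using that by (rule length_random_walk)
        have "(\<Prod>i=1..Suc n. g (f i) ((ys @ [y]) ! (i - 1)))
           = (\<Prod>i=1..n. g (f i) (ys ! (i - 1))) * g (f (Suc n)) y" for y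
        proof -
          have "(\<Prod>i=1..n. g (f i) ((ys @ [y]) ! (i - 1)))
             = (\<Prod>i=1..n. g (f i) (ys ! (i - 1)))"
            by (intro prod.cong) (auto simp: nth_append len)
          then show ?thesis by (simp add: nth_append len)
        qed
        then show ?thesis
          by (simp add: walk_op_def sum_distrib_left mult.assoc del: prod.cl_ivl_Suc)
      qed
      then show ?thesis
        unfolding expectation_random_walk_Suc[OF E(1) Suc.hyps]
        by (intro integral_cong_AE) (simp_all add: AE_measure_pmf_iff del: prod.cl_ivl_Suc)
    qed
    also have "\<dots> \<le> (\<Prod>i=1..n. R (f i)) * sqrt (energy L (walk_op E d (\<lambda>v. g (f (Suc n)) v * h v)))"
      using Suc.prems by (intro Suc.IH) auto
    also have "\<dots> \<le> (\<Prod>i=1..n. R (f i)) * sqrt ((R (f (Suc n)))\<^sup>2 * energy L h)"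
      using energy_contraction[OF avg_walk_op[OF E(1)] var g L(1) R gR, OF f_Suc f_Suc f_Suc] P
      by (intro mult_left_mono real_sqrt_le_mono) auto
    also have "\<dots> = (\<Prod>i=1..n. R (f i)) * R (f (Suc n)) * sqrt (energy L h)"
      using R[OF f_Suc] by (simp add: real_sqrt_mult)
    finally show ?case by simp
  qed
  then show ?thesis by (simp only: g_def R_def)
qed

text \<open>Convexity of the exponential function between \<open>0\<close> and \<open>ln \<alpha>\<close>.\<close>

lemma powr_le_chord:
  fixes \<alpha> t :: real
  assumes "1 < \<alpha>" "t \<in> {0..1}"
  shows "\<alpha> powr t \<le> 1 + (\<alpha> - 1) * t"
  using convex_onD[OF exp_convex, of t 0 "ln \<alpha>"] assms
  by (simp add: powr_def algebra_simps)

theorem theorem1p1: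
  fixes E :: "('v::finite) set set" and d n :: nat
    and f :: "nat \<Rightarrow> 'v \<Rightarrow> real" and \<mu> :: "nat \<Rightarrow> real" and lam \<Phi> :: real
  assumes "regular_graph E d"
    and "lam = spectral_expansion E d"
    and "n \<ge> 1"
    and "\<And>i v. i \<in> {1..n} \<Longrightarrow> f i v \<in> {0..1}"
    and "\<And>i. i \<in> {1..n} \<Longrightarrow> \<mu> i = measure_pmf.expectation (pmf_of_set UNIV) (f i)"
    and "\<Phi> = measure_pmf.expectation (random_walk E n) (walk_sum n f)"
  shows "\<Phi> = (\<Sum>i=1..n. \<mu> i) \<and>
    (\<forall>\<alpha>::real. 1 < \<alpha> \<and> (lam \<noteq> 0 \<longrightarrow> \<alpha> < 1 / lam) \<longrightarrow>
       measure_pmf.expectation (random_walk E n) (\<lambda>ys. \<alpha> powr walk_sum n f ys)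
         \<le> exp ((\<alpha> - 1) * \<Phi> * ((1 - lam) / (1 - \<alpha> * lam))))"
proof (intro conjI allI impI)
  have integrable: "integrable (measure_pmf (random_walk E n)) (F :: 'v list \<Rightarrow> real)" for F
    by (rule integrable_measure_pmf_finite[OF finite_random_walk])
  have \<mu>: "\<mu> i = avg (f i)" if "i \<in> {1..n}" for i
    using assms(5)[OF that] by (simp add: expectation_uniform)
  have "\<Phi> = (\<Sum>i=1..n. measure_pmf.expectation (random_walk E n) (\<lambda>ys. f i (ys ! (i - 1))))"
    unfolding assms(6) walk_sum_def by (intro Bochner_Integration.integral_sum integrable)
  also have "\<dots> = (\<Sum>i=1..n. \<mu> i)"
    using expectation_random_walk_nth[OF assms(1)] \<mu> by (intro sum.cong) auto
  finally show \<Phi>: "\<Phi> = (\<Sum>i=1..n. \<mu> i)" .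

  fix \<alpha> :: real
  assume "1 < \<alpha> \<and> (lam \<noteq> 0 \<longrightarrow> \<alpha> < 1 / lam)"
  then have \<alpha>: "1 < \<alpha>" and \<alpha>_lam: "lam \<noteq> 0 \<Longrightarrow> \<alpha> < 1 / lam" by auto
  have lam: "0 \<le> lam" unfolding assms(2) spectral_expansion_def
    by (rule onorm_pos_le) (rule matrix_vector_mul_bounded_linear)
  have gap: "\<alpha> * lam < 1" using lam \<alpha>_lam by (cases "lam = 0") (auto simp: field_simps)
  let ?X = "measure_pmf.expectation (random_walk E n) (\<lambda>ys. \<alpha> powr walk_sum n f ys)"
  have bound: "?X \<le> exp ((\<alpha> - 1) * \<Phi> * ((1 - L) / (1 - \<alpha> * L)))"
    if L: "lam < L" "\<alpha> * L < 1" for L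
  proof -
    have L0: "0 < L" using L lam by simp
    have L1: "L < 1" using \<alpha> L L0 by (smt (verit) mult_less_cancel_right1)
    define k where "k = (1 - L) / (1 - \<alpha> * L)"
    have k: "0 \<le> k" using L1 L by (simp add: k_def)
    have "?X \<le> measure_pmf.expectation (random_walk E n)
        (\<lambda>ys. (\<Prod>i=1..n. 1 + (\<alpha> - 1) * f i (ys ! (i - 1))) * 1)"
      unfolding walk_sum_def using \<alpha> powr_le_chord[OF \<alpha> assms(4)]
      by (intro integral_mono integrable) (auto simp: powr_sum intro!: prod_mono)
    also have "\<dots> \<le> (\<Prod>i=1..n. 1 + (\<alpha> - 1) * k * avg (f i)) * sqrt (energy L (\<lambda>v::'v. 1))"
      unfolding k_def using L assms(2)
      by (intro expectation_prod_le[OF assms(1) _ \<alpha> L0 _ assms(3)] assms(4)) auto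
    also have "\<dots> = (\<Prod>i=1..n. 1 + (\<alpha> - 1) * k * \<mu> i)"
      by (simp add: energy_def var_def \<mu>)
    also have "\<dots> \<le> (\<Prod>i=1..n. exp ((\<alpha> - 1) * k * \<mu> i))"
      using \<alpha> k assms(4) by (intro prod_mono) (auto simp: \<mu> intro!: exp_ge_add_one_self avg_nonneg add_nonneg_nonneg mult_nonneg_nonneg)
    also have "\<dots> = exp ((\<alpha> - 1) * \<Phi> * k)"
      by (simp add: \<Phi> exp_sum[symmetric] sum_distrib_left mult_ac)
    finally show ?thesis by (simp add: k_def)
  qed
  \<comment> \<open>The interval from \<open>lam\<close> to \<open>1 / \<alpha>\<close> is nonempty and the bound is continuous in \<open>L\<close> at \<open>lam\<close>.\<close>
  show "?X \<le> exp ((\<alpha> - 1) * \<Phi> * ((1 - lam) / (1 - \<alpha> * lam)))"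
  proof (rule tendsto_lowerbound)
    show "((\<lambda>L. exp ((\<alpha> - 1) * \<Phi> * ((1 - L) / (1 - \<alpha> * L))))
        \<longlongrightarrow> exp ((\<alpha> - 1) * \<Phi> * ((1 - lam) / (1 - \<alpha> * lam)))) (at_right lam)"
      using gap by (intro tendsto_intros) auto
    have "lam < 1 / \<alpha>" using gap \<alpha> by (simp add: field_simps)
    then have "\<forall>\<^sub>F L in at_right lam. L \<in> {lam<..<1 / \<alpha>}"
      by (rule eventually_at_right_real)
    then show "\<forall>\<^sub>F L in at_right lam. ?X \<le> exp ((\<alpha> - 1) * \<Phi> * ((1 - L) / (1 - \<alpha> * L)))"
      by eventually_elim (rule bound; use \<alpha> in \<open>auto simp: field_simps\<close>)
  qed simp
qed

end
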